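(* Let $n\ge 1$, $m\ge 1$, let $\Delta_n=\operatorname{conv}\{e_1,\dots,e_{n+1}\}\subseteq\mathbb{R}^{n+1}$, let $T$ be a triangulation of $\Delta_n$, and let $\lambda_1,\dots,\lambda_m$ be Sperner labelings of $T$ (matching on the original vertices, so that $e_i$ receives label $i$ under every $\lambda_j$). Let $k_1,\dots,k_m$ be positive integers with $k_1+\dots+k_m=n+m$. Then there exists an $n$-simplex $\tau$ of $T$ such that for every $j\in\{1,\dots,m\}$ the labeling $\lambda_j$ assigns at least $k_j$ pairwise distinct labels to the vertices of $\tau$.
   Context: A triangulation of $\Delta_n$ is a collection of $n$-simplices covering $\Delta_n$ with pairwise disjoint interiors such that any two intersect in a (possibly empty) common face. A Sperner labeling of $T$ is an assignment of a label in $\{1,\dots,n+1\}$ to each vertex of $T$ such that the vertex $e_i$ of $\Delta_n$ gets label $i$ and every vertex of $T$ lying in a face $\operatorname{conv}\{e_i : i\in I\}$ of $\Delta_n$ gets a label in $I$.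
   Formalization: The triangulation T is assumed to be a finite collection of simplices; for infinite collections the claim fails, e.g. for the segment cut into [0,1/4], [1/4,3/8], [3/8,7/16], … and [1/2,1]. *)

theory Defs
  imports "HOL-Analysis.Analysis"
begin

text \<open>
  For a finite index type \<open>'d\<close> with \<open>n + 1\<close> elements, the space \<open>real ^ 'd\<close> is
  \<open>\<real>\<^sup>n\<^sup>+\<^sup>1\<close>, the vector \<open>axis i 1\<close> is the standard basis vector \<open>e\<^sub>i\<close>, and the
  labels \<open>1, \<dots>, n + 1\<close> are the elements of \<open>'d\<close>.
\<close>

definition std_face :: "'d::finite set \<Rightarrow> (real ^ 'd) set" where
  "std_face I = convex hull ((\<lambda>i. axis i 1) ` I)"

abbreviation std_simplex :: "(real ^ 'd::finite) set" where
  "std_simplex \<equiv> std_face UNIV"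

definition vertices_of :: "'a::real_vector set \<Rightarrow> 'a set" where
  "vertices_of \<tau> = {v. v extreme_point_of \<tau>}"

text \<open>
  The library's \<open>triangulation\<close> says that \<open>T\<close> is finite, consists of simplices (of any
  dimension), and that any two of them intersect in a common (possibly empty) face.
  Finiteness matters: \<open>[0, 1]\<close> is also covered by infinitely many segments
  in face-to-face position, e.g. by \<open>[0, 1/4], [1/4, 3/8], [3/8, 7/16], \<dots>\<close> together with
  \<open>[1/2, 1]\<close>.  The simplices may have smaller dimension than the ambient space, so
  interiors are relative interiors.
\<close>

definition triangulation_of :: "nat \<Rightarrow> 'a::euclidean_space set set \<Rightarrow> 'a set \<Rightarrow> bool" where
  "triangulation_of n T S \<longleftrightarrow>
     triangulation T \<and>
     (\<forall>\<tau>\<in>T. int n simplex \<tau>) \<and>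
     \<Union>T = S \<and>
     pairwise (\<lambda>\<sigma> \<tau>. disjnt (rel_interior \<sigma>) (rel_interior \<tau>)) T"

definition sperner_labeling ::
    "(real ^ 'd::finite) set set \<Rightarrow> (real ^ 'd \<Rightarrow> 'd) \<Rightarrow> bool" where
  "sperner_labeling T l \<longleftrightarrow>
     (\<forall>i. l (axis i 1) = i) \<and>
     (\<forall>v\<in>(\<Union>\<tau>\<in>T. vertices_of \<tau>). \<forall>I. v \<in> std_face I \<longrightarrow> l v \<in> I)"

end

theory Submission
  imports Defs
begin

text \<open>
  Give the labeling \<open>\<lambda>\<^sub>j\<close> the weight \<open>w\<^sub>j = (k\<^sub>j - 1 + 1/m) / (n + 1)\<close>, so that the weights sum
  to \<open>1\<close>.  The piecewise linear extension \<open>f\<close> of \<open>v \<mapsto> \<Sum>\<^sub>j w\<^sub>j e\<^bsub>\<lambda>\<^sub>j(v)\<^esub>\<close> maps every face of the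
  simplex to itself, so by Brouwer's theorem it attains the barycenter, say at a point of \<open>\<tau>\<close>.
  There the contribution \<open>w\<^sub>j\<close> of \<open>\<lambda>\<^sub>j\<close> is spread over the labels of \<open>\<lambda>\<^sub>j\<close> on \<open>\<tau>\<close>, each of which
  receives at most the barycentric coordinate \<open>1/(n + 1)\<close>.  Hence there are more than \<open>k\<^sub>j - 1\<close>
  such labels.
\<close>

section \<open>Faces of the standard simplex in coordinates\<close>

text \<open>The coordinates of \<open>x\<close> are its convex coefficients over the unit vectors,
  so lying in a face becomes the vanishing of coordinates. Both the Sperner condition and the fixed
  point argument use it in that form.\<close>

lemma std_face_eq:
  "std_face I = {x. (\<forall>i. 0 \<le> x $ i) \<and> (\<forall>i. i \<notin> I \<longrightarrow> x $ i = 0) \<and> (\<Sum>i\<in>UNIV. x $ i) = 1}"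
    (is "_ = ?R")
proof
  show "std_face I \<subseteq> ?R"
    unfolding std_face_def
  proof (rule hull_minimal)
    show "(\<lambda>i. axis i 1) ` I \<subseteq> ?R"
      by (auto simp: axis_def)
    show "convex ?R"
      by (rule convexI) (auto simp: sum.distrib sum_distrib_left [symmetric])
  qed
next
  show "?R \<subseteq> std_face I"
  proof
    fix x assume x: "x \<in> ?R"
    have "(\<Sum>i\<in>I. x $ i) = (\<Sum>i\<in>UNIV. x $ i)"
      by (rule sum.mono_neutral_left) (use x in auto)
    then have "(\<Sum>i\<in>I. x $ i *\<^sub>R (axis i 1 :: real ^ 'a)) \<in> std_face I"
      unfolding std_face_def using x
      by (intro convex_sum) (auto intro: hull_inc)
    moreover have "(\<Sum>i\<in>I. x $ i *\<^sub>R (axis i 1 :: real ^ 'a)) = x"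
      using x by (auto simp: vec_eq_iff axis_def if_distrib cong: if_cong)
    ultimately show "x \<in> std_face I" by simp
  qed
qed

section \<open>Piecewise linear extension over a triangulation\<close>

text \<open>Affine independence makes the differences \<open>v - a\<close> linearly independent, so
  a linear map can be prescribed on them. All subsets \<open>S\<close> are allowed because two
  simplices are later compared on the vertices of their common face.\<close>

lemma affine_extension_exists:
  fixes g :: "'a::euclidean_space \<Rightarrow> 'b::euclidean_space"
  assumes "\<not> affine_dependent C"
  obtains A where "continuous_on UNIV A"
    and "\<And>S u. S \<subseteq> C \<Longrightarrow> sum u S = 1 \<Longrightarrow> A (\<Sum>v\<in>S. u v *\<^sub>R v) = (\<Sum>v\<in>S. u v *\<^sub>R g v)"
proof (cases "C = {}")
  case True
  show thesis by (rule that [of "\<lambda>_. 0"]) (auto simp: True)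
next
  case False
  then obtain a where a: "a \<in> C" by blast
  then have "independent ((\<lambda>x. -a + x) ` (C - {a}))"
    using assms affine_dependent_iff_dependent2 by blast
  then obtain h where h: "linear h"
    and hg: "\<And>y. y \<in> (\<lambda>x. -a + x) ` (C - {a}) \<Longrightarrow> h y = g (y + a) - g a"
    using linear_independent_extend [of _ "\<lambda>y. g (y + a) - g a"] by blast
  have hC: "h (v - a) = g v - g a" if "v \<in> C" for v
  proof (cases "v = a")
    case True
    with linear_0 [OF h] show ?thesis by simp
  next
    case False
    with that have "v - a \<in> (\<lambda>x. -a + x) ` (C - {a})"
      by (intro image_eqI [of _ _ v]) auto
    from hg [OF this] show ?thesis by simp
  qed
  show thesis
  proof (rule that [of "\<lambda>x. g a + h (x - a)"])
    show "continuous_on UNIV (\<lambda>x. g a + h (x - a))"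
      by (intro continuous_intros linear_continuous_on_compose [OF _ h])
    fix S and u :: "'a \<Rightarrow> real" assume S: "S \<subseteq> C" and u: "sum u S = 1"
    \<comment> \<open>Coefficients with sum 1 let the base point \<open>a\<close> be moved inside
      the sum, even when \<open>a\<close> is not in \<open>S\<close>.\<close>
    have "(\<Sum>v\<in>S. u v *\<^sub>R v) - a = (\<Sum>v\<in>S. u v *\<^sub>R (v - a))"
      using u by (simp add: scaleR_diff_right sum_subtractf flip: scaleR_left.sum)
    then have "h ((\<Sum>v\<in>S. u v *\<^sub>R v) - a) = (\<Sum>v\<in>S. u v *\<^sub>R h (v - a))"
      using h by (simp add: linear_sum linear_scale)
    also have "\<dots> = (\<Sum>v\<in>S. u v *\<^sub>R (g v - g a))"
      using S hC by (intro sum.cong) auto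
    also have "\<dots> = (\<Sum>v\<in>S. u v *\<^sub>R g v) - g a"
      using u by (simp add: scaleR_diff_right sum_subtractf flip: scaleR_left.sum)
    finally show "g a + h ((\<Sum>v\<in>S. u v *\<^sub>R v) - a) = (\<Sum>v\<in>S. u v *\<^sub>R g v)"
      by simp
  qed
qed

lemma simplex_vertices:
  assumes "n simplex \<tau>"
  shows "finite (vertices_of \<tau>)" "\<not> affine_dependent (vertices_of \<tau>)"
    "convex hull vertices_of \<tau> = \<tau>"
proof -
  obtain C where C: "finite C" "\<not> affine_dependent C" "\<tau> = convex hull C"
    using assms unfolding simplex by blast
  then have "vertices_of \<tau> = C"
    by (simp add: vertices_of_def extreme_point_of_convex_hull_affine_independent)
  with C show "finite (vertices_of \<tau>)" "\<not> affine_dependent (vertices_of \<tau>)"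
    "convex hull vertices_of \<tau> = \<tau>" by auto
qed

text \<open>Krein-Milman in finite dimension gives the first claim; extreme points of a face are
  extreme in the whole set, which gives the second.\<close>

lemma face_of_convex_hull_vertices:
  fixes F :: "'a::euclidean_space set"
  assumes "F face_of \<tau>" "n simplex \<tau>"
  shows "convex hull vertices_of F = F" "vertices_of F \<subseteq> vertices_of \<tau>"
proof -
  have "compact F" "convex F"
    using assms face_of_imp_compact face_of_imp_convex convex_simplex compact_simplex by blast+
  then show "convex hull vertices_of F = F"
    unfolding vertices_of_def by (metis Krein_Milman_Minkowski)
  show "vertices_of F \<subseteq> vertices_of \<tau>"
    using extreme_point_of_face [OF assms(1)] by (auto simp: vertices_of_def)
qed

text \<open>The affine extensions on the single simplices agree on common faces, and finitely many
  closed pieces paste to a continuous map.\<close>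

lemma piecewise_linear_extension_exists:
  fixes T :: "'a::euclidean_space set set" and g :: "'a \<Rightarrow> 'b::euclidean_space"
  assumes T: "triangulation T"
  shows "\<exists>f. continuous_on (\<Union>T) f \<and>
    (\<forall>\<tau>\<in>T. \<forall>u. (\<forall>v\<in>vertices_of \<tau>. 0 \<le> u v) \<longrightarrow> sum u (vertices_of \<tau>) = 1 \<longrightarrow>
      f (\<Sum>v\<in>vertices_of \<tau>. u v *\<^sub>R v) = (\<Sum>v\<in>vertices_of \<tau>. u v *\<^sub>R g v))"
proof -
  have fin: "finite T" and simp: "\<And>\<tau>. \<tau> \<in> T \<Longrightarrow> \<exists>n. n simplex \<tau>"
    and face: "\<And>\<sigma> \<tau>. \<sigma> \<in> T \<Longrightarrow> \<tau> \<in> T \<Longrightarrow> \<sigma> \<inter> \<tau> face_of \<sigma>"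
    using T by (auto simp: triangulation_def)
  define ext where "ext \<tau> A \<longleftrightarrow> continuous_on UNIV A \<and>
      (\<forall>S u. S \<subseteq> vertices_of \<tau> \<longrightarrow> sum u S = 1 \<longrightarrow>
        A (\<Sum>v\<in>S. u v *\<^sub>R v) = (\<Sum>v\<in>S. u v *\<^sub>R g v))" for \<tau> A
  have "\<exists>A. ext \<tau> A" if "\<tau> \<in> T" for \<tau>
  proof -
    have "\<not> affine_dependent (vertices_of \<tau>)"
      using simp [OF that] simplex_vertices(2) by blast
    then show ?thesis
      unfolding ext_def by (rule affine_extension_exists [where g = g]) blast
  qed
  then obtain A where ext: "\<And>\<tau>. \<tau> \<in> T \<Longrightarrow> ext \<tau> (A \<tau>)"
    by metis
  have cont: "continuous_on UNIV (A \<tau>)" if "\<tau> \<in> T" for \<tau>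
    using ext [OF that] by (simp add: ext_def)
  have A: "A \<tau> (\<Sum>v\<in>S. u v *\<^sub>R v) = (\<Sum>v\<in>S. u v *\<^sub>R g v)"
    if "\<tau> \<in> T" "S \<subseteq> vertices_of \<tau>" "sum u S = 1" for \<tau> S u
    using ext [OF that(1)] that(2,3) by (simp add: ext_def)
  have agree: "A \<sigma> x = A \<tau> x" if \<sigma>\<tau>: "\<sigma> \<in> T" "\<tau> \<in> T" and x: "x \<in> \<sigma>" "x \<in> \<tau>" for \<sigma> \<tau> x
  proof -
    \<comment> \<open>The vertices of the common face are vertices of both simplices, so one choice
      of coefficients for \<open>x\<close> over \<open>?S\<close> evaluates both affine maps to the
      same value.\<close>
    let ?S = "vertices_of (\<sigma> \<inter> \<tau>)"
    have S: "convex hull ?S = \<sigma> \<inter> \<tau>" "?S \<subseteq> vertices_of \<sigma>" "?S \<subseteq> vertices_of \<tau>"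
      using \<sigma>\<tau> simp face face_of_convex_hull_vertices by (metis Int_commute)+
    have fin: "finite ?S"
      using S(2) \<sigma>\<tau>(1) simp simplex_vertices(1) finite_subset by metis
    have "x \<in> convex hull ?S"
      using x S(1) by simp
    then obtain u where "sum u ?S = 1" "(\<Sum>v\<in>?S. u v *\<^sub>R v) = x"
      unfolding convex_hull_finite [OF fin] by blast
    then show ?thesis
      using A [OF \<sigma>\<tau>(1) S(2)] A [OF \<sigma>\<tau>(2) S(3)] by metis
  qed
  define f where "f x = A (SOME \<tau>. \<tau> \<in> T \<and> x \<in> \<tau>) x" for x
  have f: "f x = A \<tau> x" if "\<tau> \<in> T" "x \<in> \<tau>" for x \<tau>
    unfolding f_def
    by (rule agree) (use someI [of "\<lambda>\<tau>. \<tau> \<in> T \<and> x \<in> \<tau>", OF conjI [OF that]] that in auto)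
  show ?thesis
  proof (intro exI conjI ballI allI impI)
    have "continuous_on (\<Union>\<tau>\<in>T. \<tau>) f"
    proof (rule continuous_on_closed_Union [OF fin])
      fix \<tau> assume \<tau>: "\<tau> \<in> T"
      show "closed \<tau>" using simp [OF \<tau>] closed_simplex by blast
      show "continuous_on \<tau> f"
        using continuous_on_subset [OF cont [OF \<tau>]] f [OF \<tau>] by (metis continuous_on_cong subset_UNIV)
    qed
    then show "continuous_on (\<Union>T) f" by simp
    fix \<tau> and u :: "'a \<Rightarrow> real" assume \<tau>: "\<tau> \<in> T" and u: "\<forall>v\<in>vertices_of \<tau>. 0 \<le> u v" "sum u (vertices_of \<tau>) = 1"
    have "(\<Sum>v\<in>vertices_of \<tau>. u v *\<^sub>R v) \<in> convex hull vertices_of \<tau>"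
      using u simp [OF \<tau>] simplex_vertices(1)
      by (intro convex_sum) (auto intro: hull_inc)
    then have "(\<Sum>v\<in>vertices_of \<tau>. u v *\<^sub>R v) \<in> \<tau>"
      using simp [OF \<tau>] simplex_vertices(3) by blast
    then show "f (\<Sum>v\<in>vertices_of \<tau>. u v *\<^sub>R v) = (\<Sum>v\<in>vertices_of \<tau>. u v *\<^sub>R g v)"
      using f \<tau> A [OF \<tau> subset_refl u(2)] by simp
  qed
qed

section \<open>Attaining interior points by Brouwer's theorem\<close>

text \<open>Brouwer's theorem is applied to an auxiliary self-map of the simplex whose fixed points
  are exactly the points that \<open>f\<close> sends to \<open>b\<close>.\<close>

lemma face_preserving_attains:
  fixes f :: "real ^ 'd::finite \<Rightarrow> real ^ 'd" and b :: "real ^ 'd"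
  assumes cont: "continuous_on std_simplex f"
    and sum: "\<And>x. x \<in> std_simplex \<Longrightarrow> (\<Sum>i\<in>UNIV. f x $ i) = 1"
    and face: "\<And>x i. x \<in> std_simplex \<Longrightarrow> x $ i = 0 \<Longrightarrow> f x $ i = 0"
    and b: "\<And>i. 0 < b $ i" "(\<Sum>i\<in>UNIV. b $ i) = 1"
  obtains x where "x \<in> std_simplex" "f x = b"
proof -
  \<comment> \<open>\<open>h\<close> is Nash's map: it pushes \<open>x\<close> towards the coordinates in which \<open>f x\<close> falls short of
    \<open>b\<close>; at a fixed point there are none, since \<open>f\<close> preserves the facets.\<close>
  define p where "p x i = max 0 (b $ i - f x $ i)" for x i
  define s where "s x = (\<Sum>i\<in>UNIV. p x i)" for x
  define h :: "real ^ 'd \<Rightarrow> real ^ 'd" where "h x = (\<chi> i. (x $ i + p x i) / (1 + s x))" for x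
  have p0: "0 \<le> p x i" for x i by (simp add: p_def)
  have s0: "0 \<le> s x" for x unfolding s_def by (intro sum_nonneg p0)
  have contp: "continuous_on std_simplex (\<lambda>x. p x i)" for i
    unfolding p_def by (intro continuous_intros cont)
  have conth: "continuous_on std_simplex h"
    unfolding h_def
  proof (intro continuous_on_vec_lambda continuous_intros contp)
    show "continuous_on std_simplex s"
      unfolding s_def by (intro continuous_intros contp)
    show "\<forall>x\<in>std_simplex. 1 + s x \<noteq> 0"
      by (metis add_pos_nonneg less_numeral_extra(1,3) s0)
  qed
  have hS: "h x \<in> std_simplex" if "x \<in> std_simplex" for x
  proof -
    have "(\<Sum>i\<in>UNIV. h x $ i) = (\<Sum>i\<in>UNIV. x $ i + p x i) / (1 + s x)"
      by (simp add: h_def sum_divide_distrib)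
    also have "\<dots> = 1"
      using that s0 [of x] by (simp add: std_face_eq sum.distrib flip: s_def)
    finally show ?thesis
      using that p0 s0 by (auto simp: std_face_eq h_def)
  qed
  have "compact (std_simplex :: (real ^ 'd) set)" "convex (std_simplex :: (real ^ 'd) set)"
    "(std_simplex :: (real ^ 'd) set) \<noteq> {}"
    by (auto simp: std_face_def intro!: finite_imp_compact_convex_hull)
  then obtain x where x: "x \<in> std_simplex" "h x = x"
    using brouwer conth hS by (metis Pi_I)
  \<comment> \<open>At a fixed point the shortfalls \<open>p x i\<close> are proportional to the
    coordinates of \<open>x\<close>.\<close>
  have fixed: "x $ i * s x = p x i" for i
  proof -
    have "(x $ i + p x i) / (1 + s x) = x $ i"
      using x(2) by (simp add: h_def vec_eq_iff)
    then show ?thesis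
      using s0 [of x] by (simp add: divide_eq_eq algebra_simps)
  qed
  have "s x = 0"
  proof (rule ccontr)
    assume "s x \<noteq> 0"
    then have sx: "0 < s x" using s0 [of x] by simp
    have "f x $ i < b $ i" for i
    proof -
      \<comment> \<open>If \<open>x $ i\<close> were 0, then \<open>f x $ i\<close> would be 0 as
        well and the shortfall would be \<open>b $ i > 0\<close>, whereas \<open>fixed\<close>
        forces it to be 0.\<close>
      have "x $ i \<noteq> 0"
        using fixed [of i] face [OF x(1), of i] b(1) [of i] by (auto simp: p_def)
      then have "0 < x $ i"
        using x(1) by (metis (mono_tags, lifting) std_face_eq mem_Collect_eq order_le_less)
      then have "0 < p x i"
        using fixed [of i] sx by (metis mult_pos_pos)
      then show ?thesis by (simp add: p_def)
    qed
    then have "(\<Sum>i\<in>UNIV. f x $ i) < (\<Sum>i\<in>UNIV. b $ i)"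
      by (intro sum_strict_mono) auto
    then show False using sum [OF x(1)] b(2) by simp
  qed
  then have "p x i = 0" for i using fixed [of i] by simp
  then have le: "b $ i \<le> f x $ i" for i
    by (metis diff_gt_0_iff_gt max.strict_coboundedI2 not_less order_less_irrefl p_def)
  \<comment> \<open>No coordinate falls short and the totals agree, so no coordinate can exceed
    \<open>b\<close> either.\<close>
  have "(\<Sum>i\<in>UNIV. f x $ i - b $ i) = 0"
    using sum [OF x(1)] b(2) by (simp add: sum_subtractf)
  then have "f x $ i - b $ i = 0" for i
    using le by (subst (asm) sum_nonneg_eq_0_iff) auto
  then have "f x = b" by (simp add: vec_eq_iff)
  with x(1) show thesis by (rule that)
qed

section \<open>Weighted labelings and the count of labels\<close>

theorem theorem3:
  fixes n m :: nat
    and T :: "(real ^ 'd::finite) set set"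
    and l :: "nat \<Rightarrow> real ^ 'd \<Rightarrow> 'd"
    and k :: "nat \<Rightarrow> nat"
  assumes "n \<ge> 1" and "m \<ge> 1"
    and "CARD('d) = n + 1"
    and "triangulation_of n T (std_simplex :: (real ^ 'd) set)"
    and "\<forall>j\<in>{1..m}. sperner_labeling T (l j)"
    and "\<forall>j\<in>{1..m}. k j > 0"
    and "(\<Sum>j=1..m. k j) = n + m"
  shows "\<exists>\<tau>\<in>T. \<forall>j\<in>{1..m}. card (l j ` vertices_of \<tau>) \<ge> k j"
proof -
  \<comment> \<open>The numbers \<open>k j - 1\<close> add up to \<open>n\<close>; the missing unit
    is shared equally, \<open>1 / m\<close> for each labeling. This positive surplus is what rounds
    the final bound up to \<open>k j\<close>.\<close>
  define w where "w j = (real (k j) - 1 + 1 / m) / (n + 1)" for j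
  have w0: "0 \<le> w j" if "j \<in> {1..m}" for j
    using assms(6) that by (force simp: w_def Suc_le_eq)
  have "(\<Sum>j=1..m. w j) = (real (\<Sum>j=1..m. k j) - m + 1) / (n + 1)"
    using assms(2) by (simp add: w_def sum.distrib sum_subtractf flip: sum_divide_distrib)
  then have w1: "(\<Sum>j=1..m. w j) = 1"
    unfolding assms(7) by simp
  define g :: "real ^ 'd \<Rightarrow> real ^ 'd" where "g v = (\<Sum>j=1..m. w j *\<^sub>R axis (l j v) 1)" for v
  have g: "g v $ i = (\<Sum>j=1..m. w j * of_bool (l j v = i))" for v i
    unfolding g_def sum_component by (rule sum.cong) (auto simp: axis_def)
  have gsum: "(\<Sum>i\<in>UNIV. g v $ i) = 1" for v
    unfolding g by (subst sum.swap) (use w1 in \<open>simp add: of_bool_def if_distrib cong: if_cong\<close>)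
  have tri: "triangulation T" and UT: "\<Union>T = (std_simplex :: (real ^ 'd) set)"
    and simplex: "\<And>\<tau>. \<tau> \<in> T \<Longrightarrow> int n simplex \<tau>"
    using assms(4) by (auto simp: triangulation_of_def)
  obtain f where contf: "continuous_on (\<Union>T) f"
    and f: "\<forall>\<tau>\<in>T. \<forall>u. (\<forall>v\<in>vertices_of \<tau>. 0 \<le> u v) \<longrightarrow> sum u (vertices_of \<tau>) = 1 \<longrightarrow>
      f (\<Sum>v\<in>vertices_of \<tau>. u v *\<^sub>R v) = (\<Sum>v\<in>vertices_of \<tau>. u v *\<^sub>R g v)"
    using piecewise_linear_extension_exists [OF tri, of g] by (elim exE conjE) (rule that)
  have point: "\<exists>\<tau>\<in>T. \<exists>u. (\<forall>v\<in>vertices_of \<tau>. 0 \<le> u v) \<and> sum u (vertices_of \<tau>) = 1 \<and>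
      x = (\<Sum>v\<in>vertices_of \<tau>. u v *\<^sub>R v) \<and> f x = (\<Sum>v\<in>vertices_of \<tau>. u v *\<^sub>R g v)"
    if x: "x \<in> std_simplex" for x
  proof -
    obtain \<tau> where \<tau>: "\<tau> \<in> T" "x \<in> \<tau>"
      using x UT by blast
    note V = simplex_vertices [OF simplex [OF \<tau>(1)]]
    have "x \<in> convex hull vertices_of \<tau>"
      using \<tau>(2) V(3) by simp
    then obtain u where u: "\<forall>v\<in>vertices_of \<tau>. 0 \<le> u v" "sum u (vertices_of \<tau>) = 1"
      "x = (\<Sum>v\<in>vertices_of \<tau>. u v *\<^sub>R v)"
      unfolding convex_hull_finite [OF V(1)] by blast
    have "f x = (\<Sum>v\<in>vertices_of \<tau>. u v *\<^sub>R g v)"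
      unfolding u(3) by (rule f [rule_format, OF \<tau>(1) u(1) [rule_format] u(2)])
    with u show ?thesis
      by (intro bexI [OF _ \<tau>(1)] exI [of _ u] conjI)
  qed
  have fsum: "(\<Sum>i\<in>UNIV. f x $ i) = 1" if x: "x \<in> std_simplex" for x
  proof -
    obtain \<tau> u where "sum u (vertices_of \<tau>) = 1" "f x = (\<Sum>v\<in>vertices_of \<tau>. u v *\<^sub>R g v)"
      using point [OF x] by blast
    then show ?thesis
      by (simp, subst sum.swap) (simp add: gsum flip: sum_distrib_left)
  qed
  have fface: "f x $ i = 0" if x: "x \<in> std_simplex" "x $ i = 0" for x i
  proof -
    obtain \<tau> u where \<tau>: "\<tau> \<in> T" and u: "\<forall>v\<in>vertices_of \<tau>. 0 \<le> u v"
      and xu: "x = (\<Sum>v\<in>vertices_of \<tau>. u v *\<^sub>R v)"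
      and fx: "f x = (\<Sum>v\<in>vertices_of \<tau>. u v *\<^sub>R g v)"
      using point [OF x(1)] by blast
    have VS: "v \<in> std_simplex" if "v \<in> vertices_of \<tau>" for v
      using that \<tau> UT by (auto simp: vertices_of_def extreme_point_of_def)
    have "(\<Sum>v\<in>vertices_of \<tau>. u v * v $ i) = 0"
      using x(2) xu by simp
    moreover have "0 \<le> u v * v $ i" if "v \<in> vertices_of \<tau>" for v
      using VS [OF that] u that by (simp add: std_face_eq)
    \<comment> \<open>Nonnegative terms with sum 0 vanish, so every vertex of positive weight lies
      on the facet opposite to \<open>axis i 1\<close>.\<close>
    ultimately have zero: "u v * v $ i = 0" if "v \<in> vertices_of \<tau>" for v
      using that simplex_vertices(1) [OF simplex [OF \<tau>]] by (simp add: sum_nonneg_eq_0_iff)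
    have "u v * g v $ i = 0" if v: "v \<in> vertices_of \<tau>" for v
    proof (cases "u v = 0")
      case False
      \<comment> \<open>On this facet the Sperner condition forbids the label \<open>i\<close> to
        every labeling.\<close>
      then have "v \<in> std_face (UNIV - {i})"
        using zero [OF v] VS [OF v] by (simp add: std_face_eq)
      then have "l j v \<noteq> i" if "j \<in> {1..m}" for j
        using assms(5) that v \<tau> unfolding sperner_labeling_def by blast
      then show ?thesis by (simp add: g)
    qed simp
    then have "(\<Sum>v\<in>vertices_of \<tau>. u v * g v $ i) = 0"
      by (rule sum.neutral [OF ballI])
    then show ?thesis by (simp add: fx)
  qed
  define b :: "real ^ 'd" where "b = (\<chi> i. 1 / (n + 1))"
  obtain x where x: "x \<in> std_simplex" "f x = b"
  proof (rule face_preserving_attains [of f b])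
    show "continuous_on std_simplex f" using contf by (simp add: UT)
    show "0 < b $ i" "(\<Sum>i\<in>UNIV. b $ i) = 1" for i
      using assms(3) by (simp_all add: b_def)
  qed (use fsum fface in auto)
  obtain \<tau> u where \<tau>: "\<tau> \<in> T" and u: "\<forall>v\<in>vertices_of \<tau>. 0 \<le> u v" "sum u (vertices_of \<tau>) = 1"
    and bu: "b = (\<Sum>v\<in>vertices_of \<tau>. u v *\<^sub>R g v)"
    using point [OF x(1)] x(2) by metis
  define V where "V = vertices_of \<tau>"
  have finV: "finite V"
    using simplex_vertices(1) [OF simplex [OF \<tau>]] by (simp add: V_def)
  \<comment> \<open>Entry \<open>c j i\<close> is the share of labeling \<open>j\<close> in
    coordinate \<open>i\<close> of the barycenter. The resulting nonnegative matrix has column sums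
    \<open>1 / (n + 1)\<close> and row sums \<open>w j\<close>.\<close>
  define c where "c j i = w j * (\<Sum>v\<in>V. u v * of_bool (l j v = i))" for j i
  have c0: "0 \<le> c j i" if "j \<in> {1..m}" for j i
    using w0 [OF that] u(1) by (auto simp: c_def V_def intro!: mult_nonneg_nonneg sum_nonneg)
  have col: "(\<Sum>j=1..m. c j i) = 1 / (n + 1)" for i
  proof -
    have "(\<Sum>j=1..m. c j i) = (\<Sum>v\<in>V. u v * g v $ i)"
      unfolding c_def g sum_distrib_left by (subst sum.swap) (simp add: ac_simps)
    also have "\<dots> = b $ i" by (simp add: bu V_def)
    finally show ?thesis by (simp add: b_def)
  qed
  have "k j \<le> card (l j ` V)" if j: "j \<in> {1..m}" for j
  proof -
    have "w j = (\<Sum>v\<in>V. w j * u v)"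
      using u(2) by (simp add: V_def flip: sum_distrib_left)
    \<comment> \<open>Each vertex has exactly one label under \<open>l j\<close>, so row
      \<open>j\<close> is supported on the labels that occur on \<open>V\<close>.\<close>
    also have "\<dots> = (\<Sum>i\<in>l j ` V. c j i)"
      unfolding c_def sum_distrib_left using finV
      by (subst sum.swap) (auto intro!: sum.cong simp: of_bool_def if_distrib cong: if_cong)
    also have "\<dots> \<le> (\<Sum>i\<in>l j ` V. 1 / (n + 1))"
    proof (rule sum_mono)
      fix i
      show "c j i \<le> 1 / (n + 1)"
        \<comment> \<open>A single entry of a nonnegative column is at most the column sum.\<close>
        unfolding col [symmetric, of i] using j c0 by (intro member_le_sum) auto
    qed
    finally have "w j \<le> real (card (l j ` V)) / (n + 1)"
      by simp
    then have "real (k j) - 1 + 1 / m \<le> card (l j ` V)"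
      unfolding w_def divide_le_cancel by simp
    \<comment> \<open>The cardinality strictly exceeds \<open>k j - 1\<close>, hence by integrality
      it is at least \<open>k j\<close>.\<close>
    moreover have "0 < 1 / real m"
      using assms(2) by simp
    ultimately show ?thesis by linarith
  qed
  with \<tau> show ?thesis unfolding V_def by blast
qed

end
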